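(* Let $R>0$, let $\Lambda := \{\lambda\in\mathbb{R}_+^m : \|\lambda\|_1\le R\}$, and let $\theta^{(1)},\dots,\theta^{(T)}\in\Theta$ and $\lambda^{(1)},\dots,\lambda^{(T)}\in\Lambda$ be sequences satisfying $$\max_{\lambda^*\in\Lambda}\frac1T\sum_{t=1}^T\mathcal{L}(\theta^{(t)},\lambda^* )-\inf_{\theta^*\in\Theta}\frac1T\sum_{t=1}^T\mathcal{L}(\theta^*,\lambda^{(t)})\le\epsilon .$$ Let $\bar\theta$ be a random variable with $\bar\theta=\theta^{(t)}$ with probability $1/T$ (i.e. $\bar\theta=\theta^{(t)}$ with $t$ uniform on $\{1,\dots,T\}$), and let $\bar\lambda:=\frac1T\sum_{t=1}^T\lambda^{(t)}$. Then: (1) (near-optimality) $$\mathbb{E}_{\bar\theta}[g_0(\bar\theta)]\le\inf_{\theta^*\in\Theta:\ \forall i\in\{1,\dots,m\},\ g_i(\theta^* )\le 0}g_0(\theta^* )+\epsilon .$$ (2) (near-feasibility) If $\|\bar\lambda\|_1<R$, then $$\max_{i\in\{1,\dots,m\}}\mathbb{E}_{\bar\theta}[g_i(\bar\theta)]\le\frac{\epsilon}{R-\|\bar\lambda\|_1}.$$ (3) If there exist $\gamma>0$ and $\theta'\in\Theta$ with $g_i(\theta')\le-\gamma$ for all $i\in\{1,\dots,m\}$, then $$\|\bar\lambda\|_1\le\frac{\epsilon+B_{g_0}}{\gamma},$$ where $B_{g_0}\ge\sup_{\theta\in\Theta}g_0(\theta)-\inf_{\theta\in\Theta}g_0(\theta)$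 is a bound on the range of $g_0$.
   Context: $\Theta$ is a (nonempty) set, $g_0,g_1,\dots,g_m:\Theta\to\mathbb{R}$ are arbitrary functions. The constrained problem is to minimize $g_0(\theta)$ over $\theta\in\Theta$ subject to $g_i(\theta)\le0$ for all $i\in\{1,\dots,m\}$. The Lagrangian is $\mathcal{L}(\theta,\lambda):=g_0(\theta)+\sum_{i=1}^m\lambda_ig_i(\theta)$. The infimum over an empty set is $+\infty$. No convexity is assumed. *)

theory Defs
  imports "HOL-Probability.Probability"
begin

text \<open>
  The constraint indices \<open>1, \<dots>, m\<close> are represented by a finite type \<open>'m\<close>, so that
  multipliers are vectors of type \<^typ>\<open>real ^ 'm\<close>; the objective \<open>g0\<close> is kept apart from
  the constraint functions \<open>g\<close>.
\<close>

definition lagrangian ::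
    "('a \<Rightarrow> real) \<Rightarrow> ('m::finite \<Rightarrow> 'a \<Rightarrow> real) \<Rightarrow> 'a \<Rightarrow> real ^ 'm \<Rightarrow> real" where
  "lagrangian g0 g \<theta> lam = g0 \<theta> + (\<Sum>i\<in>UNIV. lam $ i * g i \<theta>)"

definition l1_norm :: "real ^ 'm::finite \<Rightarrow> real" where
  "l1_norm x = (\<Sum>i\<in>UNIV. \<bar>x $ i\<bar>)"

definition multipliers :: "real \<Rightarrow> (real ^ 'm::finite) set" where
  "multipliers R = {lam. (\<forall>i. 0 \<le> lam $ i) \<and> l1_norm lam \<le> R}"

definition feasible :: "'a set \<Rightarrow> ('m::finite \<Rightarrow> 'a \<Rightarrow> real) \<Rightarrow> 'a set" where
  "feasible \<Theta> g = {\<theta> \<in> \<Theta>. \<forall>i. g i \<theta> \<le> 0}"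

text \<open>
  Suprema and infima over infinite sets are taken in \<^typ>\<open>ereal\<close>, so that an unbounded infimum
  is \<open>-\<infinity>\<close> and the infimum over the empty set is \<open>\<infinity>\<close>. The supremum over \<^const>\<open>multipliers\<close>
  below is a finite maximum when \<open>R > 0\<close>: see \<open>SUP_lagrangian_attained\<close>.
\<close>

definition duality_gap ::
    "'a set \<Rightarrow> ('a \<Rightarrow> real) \<Rightarrow> ('m::finite \<Rightarrow> 'a \<Rightarrow> real) \<Rightarrow> real \<Rightarrow> nat
      \<Rightarrow> (nat \<Rightarrow> 'a) \<Rightarrow> (nat \<Rightarrow> real ^ 'm) \<Rightarrow> ereal" where
  "duality_gap \<Theta> g0 g R T \<theta> lam =
     (SUP \<mu>\<in>multipliers R. ereal (1 / real T * (\<Sum>t=1..T. lagrangian g0 g (\<theta> t) \<mu>)))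
     - (INF \<eta>\<in>\<Theta>. ereal (1 / real T * (\<Sum>t=1..T. lagrangian g0 g \<eta> (lam t))))"

definition random_iterate :: "nat \<Rightarrow> (nat \<Rightarrow> 'a) \<Rightarrow> 'a pmf" where
  "random_iterate T \<theta> = map_pmf \<theta> (pmf_of_set {1..T})"

definition average_multiplier :: "nat \<Rightarrow> (nat \<Rightarrow> real ^ 'm::finite) \<Rightarrow> real ^ 'm" where
  "average_multiplier T lam = (1 / real T) *\<^sub>R (\<Sum>t=1..T. lam t)"

lemma compact_multipliers: "compact (multipliers R :: (real ^ 'm::finite) set)"
proof -
  have eq: "multipliers R = (\<Inter>i. {lam::real^'m. 0 \<le> lam $ i}) \<inter> {lam. (\<Sum>i\<in>UNIV. \<bar>lam $ i\<bar>) \<le> R}"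
    by (auto simp: multipliers_def l1_norm_def)
  have "closed (multipliers R :: (real ^ 'm) set)"
    unfolding eq by (intro closed_Int closed_INT ballI closed_Collect_le continuous_intros)
  moreover have "bounded (multipliers R :: (real ^ 'm) set)"
    unfolding bounded_iff
    by (rule exI[of _ R])
      (auto simp: multipliers_def l1_norm_def intro: order_trans[OF norm_le_l1_cart])
  ultimately show ?thesis
    by (simp add: compact_eq_bounded_closed)
qed

lemma SUP_lagrangian_attained:
  fixes g :: "'m::finite \<Rightarrow> 'a \<Rightarrow> real"
  assumes "R > 0"
  shows "\<exists>\<mu>\<in>multipliers R.
    (SUP \<mu>'\<in>multipliers R. ereal (1 / real T * (\<Sum>t=1..T. lagrangian g0 g (\<theta> t) \<mu>')))
      = ereal (1 / real T * (\<Sum>t=1..T. lagrangian g0 g (\<theta> t) \<mu>))"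
proof -
  let ?f = "\<lambda>\<mu>. 1 / real T * (\<Sum>t=1..T. lagrangian g0 g (\<theta> t) \<mu>)"
  have "0 \<in> (multipliers R :: (real ^ 'm) set)"
    using assms by (simp add: multipliers_def l1_norm_def)
  then have ne: "(multipliers R :: (real ^ 'm) set) \<noteq> {}" by blast
  have "continuous_on (multipliers R) ?f"
    unfolding lagrangian_def by (intro continuous_intros)
  from continuous_attains_sup[OF compact_multipliers ne this]
  obtain \<mu> where \<mu>: "\<mu> \<in> multipliers R" "\<forall>\<mu>'\<in>multipliers R. ?f \<mu>' \<le> ?f \<mu>" by blast
  have "(SUP \<mu>'\<in>multipliers R. ereal (?f \<mu>')) = ereal (?f \<mu>)"
    by (rule SUP_eqI) (use \<mu> in auto)
  with \<mu>(1) show ?thesis by blast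
qed

end

theory Submission imports Defs begin

text \<open>
  By linearity of the Lagrangian in the multiplier, the gap hypothesis says that
  \<open>E g0 + \<Sum> \<mu>\<^sub>i E g\<^sub>i \<le> L(\<eta>, lambar) + \<epsilon>\<close> for all \<open>\<mu>\<close> in \<open>multipliers R\<close> and all \<open>\<eta>\<close> in \<open>\<Theta>\<close>.
  Part (1) takes \<open>\<mu> = 0\<close> and a feasible \<open>\<eta>\<close>. Part (2) averages over \<open>\<eta> = \<theta> t\<close> and takes for \<open>\<mu>\<close>
  the vector \<open>lambar\<close> with the remaining budget \<open>R - l1_norm lambar\<close> added to one coordinate.
  Part (3) takes \<open>\<mu> = 0\<close> and the Slater point \<open>\<eta> = \<theta>'\<close>.
\<close>

lemma expectation_random_iterate:
  fixes f :: "'a \<Rightarrow> real"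
  assumes "T \<ge> 1"
  shows "measure_pmf.expectation (random_iterate T \<theta>) f = (\<Sum>t=1..T. f (\<theta> t)) / real T"
  using assms by (simp add: random_iterate_def integral_pmf_of_set)

lemma zero_in_multipliers: "R \<ge> 0 \<Longrightarrow> 0 \<in> multipliers R"
  by (simp add: multipliers_def l1_norm_def)

lemma l1_norm_nonneg_vector:
  assumes "\<And>i. 0 \<le> x $ i"
  shows "l1_norm x = (\<Sum>i\<in>UNIV. x $ i)"
  using assms by (simp add: l1_norm_def)

text \<open>For a fixed multiplier the Lagrangian is linear in the values of \<open>g0\<close> and
  the \<open>g i\<close>, so after swapping the two sums the iterates enter only through
  expectations.\<close>

lemma average_lagrangian_iterates:
  assumes "T \<ge> 1"
  shows "1 / real T * (\<Sum>t=1..T. lagrangian g0 g (\<theta> t) \<mu>) =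
    measure_pmf.expectation (random_iterate T \<theta>) g0
      + (\<Sum>i\<in>UNIV. \<mu> $ i * measure_pmf.expectation (random_iterate T \<theta>) (g i))"
proof -
  have "(\<Sum>t=1..T. \<Sum>i\<in>UNIV. \<mu> $ i * g i (\<theta> t)) = (\<Sum>i\<in>UNIV. \<mu> $ i * (\<Sum>t=1..T. g i (\<theta> t)))"
    by (subst sum.swap) (simp add: sum_distrib_left)
  then show ?thesis
    using assms
    by (simp add: expectation_random_iterate lagrangian_def sum.distrib add_divide_distrib
        flip: sum_divide_distrib)
qed

text \<open>The Lagrangian is affine in the multiplier and the weights \<open>1 / real T\<close> sum
  to one, so averaging commutes with it and leaves \<open>g0 \<eta>\<close> unchanged.\<close>

lemma average_lagrangian_multipliers:
  assumes "T \<ge> 1"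
  shows "1 / real T * (\<Sum>t=1..T. lagrangian g0 g \<eta> (lam t)) =
    lagrangian g0 g \<eta> (average_multiplier T lam)"
proof -
  have "(\<Sum>t=1..T. \<Sum>i\<in>UNIV. lam t $ i * g i \<eta>) = (\<Sum>i\<in>UNIV. (\<Sum>t=1..T. lam t $ i) * g i \<eta>)"
    by (subst sum.swap) (simp add: sum_distrib_right)
  then show ?thesis
    using assms
    by (simp add: average_multiplier_def lagrangian_def sum.distrib add_divide_distrib
        flip: sum_divide_distrib)
qed

lemma average_multiplier_nonneg:
  assumes "\<And>t. t \<in> {1..T} \<Longrightarrow> lam t \<in> multipliers R"
  shows "0 \<le> average_multiplier T lam $ i"
proof -
  have "0 \<le> (\<Sum>t=1..T. lam t $ i)"
    by (rule sum_nonneg) (use assms in \<open>auto simp: multipliers_def\<close>)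
  then show ?thesis
    by (simp add: average_multiplier_def)
qed

text \<open>This turns the \<open>ereal\<close> hypothesis into a real inequality. Replacing the
  supremum and the infimum by single members can only shrink the difference, and no finiteness of
  the infimum has to be shown first.\<close>

lemma duality_gap_bound:
  assumes "duality_gap \<Theta> g0 g R T \<theta> lam \<le> ereal \<epsilon>" "\<mu> \<in> multipliers R" "\<eta> \<in> \<Theta>" "T \<ge> 1"
  shows "1 / real T * (\<Sum>t=1..T. lagrangian g0 g (\<theta> t) \<mu>)
    \<le> lagrangian g0 g \<eta> (average_multiplier T lam) + \<epsilon>"
proof -
  let ?a = "1 / real T * (\<Sum>t=1..T. lagrangian g0 g (\<theta> t) \<mu>)"
  let ?b = "1 / real T * (\<Sum>t=1..T. lagrangian g0 g \<eta> (lam t))"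
  have "ereal ?a - ereal ?b \<le> duality_gap \<Theta> g0 g R T \<theta> lam"
    unfolding duality_gap_def
    by (intro ereal_minus_mono SUP_upper INF_lower assms)
  also note assms(1)
  finally have "ereal (?a - ?b) \<le> ereal \<epsilon>"
    by (simp only: ereal_minus(1))
  then have "?a \<le> ?b + \<epsilon>" by simp
  then show ?thesis
    unfolding average_lagrangian_multipliers[OF assms(4)] .
qed

theorem theorem1:
  fixes \<Theta> :: "'a set"
    and g0 :: "'a \<Rightarrow> real"
    and g :: "'m::finite \<Rightarrow> 'a \<Rightarrow> real"
    and R \<epsilon> :: real
    and T :: nat
    and \<theta> :: "nat \<Rightarrow> 'a"
    and lam :: "nat \<Rightarrow> real ^ 'm"
    and \<theta>bar :: "'a pmf"
    and lambar :: "real ^ 'm"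
  assumes "\<Theta> \<noteq> {}"
    and "R > 0"
    and "T \<ge> 1"
    and "\<And>t. t \<in> {1..T} \<Longrightarrow> \<theta> t \<in> \<Theta>"
    and "\<And>t. t \<in> {1..T} \<Longrightarrow> lam t \<in> multipliers R"
    and "duality_gap \<Theta> g0 g R T \<theta> lam \<le> ereal \<epsilon>"
    and "\<theta>bar = random_iterate T \<theta>"
    and "lambar = average_multiplier T lam"
  shows
    "ereal (measure_pmf.expectation \<theta>bar g0) \<le> (INF \<eta>\<in>feasible \<Theta> g. ereal (g0 \<eta>)) + ereal \<epsilon>
     \<and> (l1_norm lambar < R \<longrightarrow>
          (MAX i. measure_pmf.expectation \<theta>bar (g i)) \<le> \<epsilon> / (R - l1_norm lambar))
     \<and> (\<forall>\<gamma> B. \<gamma> > 0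
          \<and> (\<exists>\<theta>'\<in>\<Theta>. \<forall>i. g i \<theta>' \<le> - \<gamma>)
          \<and> (SUP \<eta>\<in>\<Theta>. ereal (g0 \<eta>)) - (INF \<eta>\<in>\<Theta>. ereal (g0 \<eta>)) \<le> ereal B
          \<longrightarrow> l1_norm lambar \<le> (\<epsilon> + B) / \<gamma>)"
proof -
  define E where "E f = measure_pmf.expectation \<theta>bar f" for f :: "'a \<Rightarrow> real"
  have E_eq: "E f = (\<Sum>t=1..T. f (\<theta> t)) / real T" for f
    unfolding E_def assms(7) by (rule expectation_random_iterate[OF assms(3)])
  \<comment> \<open>The comparison is asked for at the iterates only: they lie in
    \<open>\<Theta>\<close>, where the later pointwise bounds are available.\<close>
  have E_mono: "E f \<le> E h" if "\<And>t. t \<in> {1..T} \<Longrightarrow> f (\<theta> t) \<le> h (\<theta> t)" for f h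
    unfolding E_eq using that by (intro divide_right_mono sum_mono) auto
  have E_const: "E (\<lambda>_. c) = c" for c
    by (simp add: E_def)
  have lagrangian_iterates: "1 / real T * (\<Sum>t=1..T. lagrangian g0 g (\<theta> t) \<mu>) =
      E g0 + (\<Sum>i\<in>UNIV. \<mu> $ i * E (g i))" for \<mu>
    unfolding E_def assms(7) by (rule average_lagrangian_iterates[OF assms(3)])
  have nonneg: "0 \<le> lambar $ i" for i
    unfolding assms(8) using assms(5) by (rule average_multiplier_nonneg)
  have gap: "E g0 + (\<Sum>i\<in>UNIV. \<mu> $ i * E (g i)) \<le> lagrangian g0 g \<eta> lambar + \<epsilon>"
    if "\<mu> \<in> multipliers R" "\<eta> \<in> \<Theta>" for \<mu> \<eta>
    using duality_gap_bound[OF assms(6) that assms(3)]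
    unfolding lagrangian_iterates assms(8) .
  have gap0: "E g0 \<le> lagrangian g0 g \<eta> lambar + \<epsilon>" if "\<eta> \<in> \<Theta>" for \<eta>
    using gap[OF zero_in_multipliers that] assms(2) by simp

  have optimality: "ereal (E g0) \<le> (INF \<eta>\<in>feasible \<Theta> g. ereal (g0 \<eta>)) + ereal \<epsilon>"
  proof -
    \<comment> \<open>With \<epsilon> on the left, a bound at each feasible point suffices. This
      also covers an empty feasible set, whose infimum is \<infinity>.\<close>
    have "ereal (E g0 - \<epsilon>) \<le> (INF \<eta>\<in>feasible \<Theta> g. ereal (g0 \<eta>))"
    proof (rule INF_greatest)
      fix \<eta> assume \<eta>: "\<eta> \<in> feasible \<Theta> g"
      then have "(\<Sum>i\<in>UNIV. lambar $ i * g i \<eta>) \<le> 0"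
        using nonneg by (intro sum_nonpos mult_nonneg_nonpos) (auto simp: feasible_def)
      with gap0[of \<eta>] \<eta> show "ereal (E g0 - \<epsilon>) \<le> ereal (g0 \<eta>)"
        by (simp add: feasible_def lagrangian_def)
    qed
    then have "ereal (E g0 - \<epsilon>) + ereal \<epsilon> \<le> (INF \<eta>\<in>feasible \<Theta> g. ereal (g0 \<eta>)) + ereal \<epsilon>"
      by (rule add_right_mono)
    then show ?thesis by simp
  qed

  have feasibility: "(MAX i. E (g i)) \<le> \<epsilon> / (R - l1_norm lambar)" if less: "l1_norm lambar < R"
  proof -
    have "E (g j) \<le> \<epsilon> / (R - l1_norm lambar)" for j
    proof -
      define r where "r = R - l1_norm lambar"
      define \<mu> where "\<mu> = lambar + axis j r"
      have r: "r > 0" using less by (simp add: r_def)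
      have \<mu>: "\<mu> $ i = lambar $ i + (if i = j then r else 0)" for i
        by (simp add: \<mu>_def axis_def)
      have "0 \<le> \<mu> $ i" for i
        using nonneg[of i] r by (simp add: \<mu>)
      moreover from this have "l1_norm \<mu> = R"
        by (simp add: l1_norm_nonneg_vector \<mu> sum.distrib r_def nonneg)
      ultimately have "\<mu> \<in> multipliers R"
        by (simp add: multipliers_def)
      \<comment> \<open>The left side of \<open>gap\<close> does not depend on
        \<open>\<eta>\<close>, so applying it at every iterate and averaging keeps that side as it
        is.\<close>
      then have "E (\<lambda>_. E g0 + (\<Sum>i\<in>UNIV. \<mu> $ i * E (g i)) - \<epsilon>)
          \<le> E (\<lambda>\<eta>. lagrangian g0 g \<eta> lambar)"
        using gap assms(4) by (intro E_mono) (simp add: algebra_simps)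
      also have "\<dots> = E g0 + (\<Sum>i\<in>UNIV. lambar $ i * E (g i))"
        using lagrangian_iterates[of lambar] by (simp add: E_eq)
      finally have "(\<Sum>i\<in>UNIV. \<mu> $ i * E (g i)) - \<epsilon> \<le> (\<Sum>i\<in>UNIV. lambar $ i * E (g i))"
        by (simp add: E_const)
      \<comment> \<open>Both sides now share the \<open>lambar\<close> terms. Cancelling them leaves
        only the contribution of the extra budget \<open>r\<close> at coordinate
        \<open>j\<close>.\<close>
      moreover have "(\<Sum>i\<in>UNIV. \<mu> $ i * E (g i)) = (\<Sum>i\<in>UNIV. lambar $ i * E (g i)) + r * E (g j)"
        by (simp add: \<mu> distrib_right sum.distrib if_distrib[of "\<lambda>x. x * _"] cong: if_cong)
      ultimately have "r * E (g j) \<le> \<epsilon>" by simp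
      with r show ?thesis
        by (simp add: r_def pos_le_divide_eq mult.commute)
    qed
    then show ?thesis by simp
  qed

  have multiplier_bound: "l1_norm lambar \<le> (\<epsilon> + B) / \<gamma>"
    if \<gamma>: "\<gamma> > 0" and \<theta>': "\<theta>' \<in> \<Theta>" "\<And>i. g i \<theta>' \<le> - \<gamma>"
      and B: "(SUP \<eta>\<in>\<Theta>. ereal (g0 \<eta>)) - (INF \<eta>\<in>\<Theta>. ereal (g0 \<eta>)) \<le> ereal B"
    for \<gamma> B \<theta>'
  proof -
    \<comment> \<open>The range bound limits the difference of any two values of \<open>g0\<close>
      on \<open>\<Theta>\<close>; averaged over the iterates, it bounds \<open>E g0\<close> from
      below.\<close>
    have "g0 \<theta>' - B \<le> g0 \<eta>" if "\<eta> \<in> \<Theta>" for \<eta>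
    proof -
      have "ereal (g0 \<theta>') - ereal (g0 \<eta>) \<le> (SUP \<eta>\<in>\<Theta>. ereal (g0 \<eta>)) - (INF \<eta>\<in>\<Theta>. ereal (g0 \<eta>))"
        using \<theta>'(1) that by (intro ereal_minus_mono SUP_upper INF_lower)
      from order_trans[OF this B] show ?thesis by simp
    qed
    then have "E (\<lambda>_. g0 \<theta>' - B) \<le> E g0"
      using assms(4) by (intro E_mono) auto
    then have "g0 \<theta>' - B \<le> E g0"
      by (simp only: E_const)
    moreover have "(\<Sum>i\<in>UNIV. lambar $ i * g i \<theta>') \<le> (\<Sum>i\<in>UNIV. lambar $ i * - \<gamma>)"
      using nonneg \<theta>'(2) by (intro sum_mono mult_left_mono)
    then have "(\<Sum>i\<in>UNIV. lambar $ i * g i \<theta>') \<le> - (l1_norm lambar * \<gamma>)"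
      by (simp add: l1_norm_nonneg_vector nonneg sum_distrib_right sum_negf)
    \<comment> \<open>The chain \<open>g0 \<theta>' - B \<le> E g0 \<le> g0 \<theta>' - l1_norm
      lambar * \<gamma> + \<epsilon>\<close> lets \<open>g0 \<theta>'\<close> cancel.\<close>
    ultimately have "l1_norm lambar * \<gamma> \<le> \<epsilon> + B"
      using gap0[OF \<theta>'(1)] by (simp add: lagrangian_def)
    with \<gamma> show ?thesis by (simp add: pos_le_divide_eq)
  qed

  show ?thesis
    using optimality feasibility multiplier_bound unfolding E_def by blast
qed

end
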